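(* Let $\mathbb U$ be the universal Urysohn space and let $X$ be a compact metric space. (1) If $X$ is a Rakotch fractal, then $X$ is isometric to the attractor $A_{\mathcal{G}}$ of a function system $\mathcal{G}$ consisting of Rakotch contractions of $\mathbb U$. (2) If $X$ is a Banach fractal, then $X$ is isometric to the attractor $A_{\mathcal{G}}$ of a function system $\mathcal{G}$ consisting of Banach contractions of $\mathbb U$.
   Context: The universal Urysohn space $\mathbb U$ is the (unique up to isometry) separable complete metric space such that every isometric embedding $f:B\to\mathbb U$ of a subspace $B$ of a finite metric space $A$ extends to an isometric embedding $\bar f:A\to\mathbb U$. A function system on a metric space $X$ is a finite family of continuous self-maps of $X$; it induces $\mathcal{F}:\mathbb K(X)\to\mathbb K(X)$, $K\mapsto\bigcup_{f\in\mathcal{F}}f(K)$, on the space $\mathbb K(X)$ of non-empty compact subsets of $X$ with the Hausdorff metric. A compact $A\in\mathbb K(X)$ is the attractor $A_{\mathcal{F}}$ of $\mathcal{F}$ if $\mathcal{F}(A)=A$ and $\mathcal{F}^n(K)\to A$ in $\mathbb K(X)$ for every $K\in\mathbb K(X)$. A map $f:(X,d_X)\to(Y,d_Y)$ is Rakotch contracting if there is $\varphi:[0,\infty)\to[0,\infty)$ with $d_Y(f(x),f(x'))\le\varphi(d_X(x,x'))$ for all $x,x'$ and $\sup_{a<t<\infty}\varphi(t)/t<1$ for every $a>0$; it is a Banach contraction if it is Lipschitz with Lipschitz constant $<1$. A compact metric space $X$ is a Rakotch fractal (resp. Banach fractal) if $X=\bigcup_{f\in\mathcal{F}}f(X)$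 for some function system $\mathcal{F}$ consisting of Rakotch contractions (resp. Banach contractions) of $X$. *)

theory Defs
  imports "HOL-Analysis.Analysis"
begin

definition isometric_embedding ::
  "'a set \<Rightarrow> ('a \<Rightarrow> 'a \<Rightarrow> real) \<Rightarrow> 'b set \<Rightarrow> ('b \<Rightarrow> 'b \<Rightarrow> real) \<Rightarrow> ('a \<Rightarrow> 'b) \<Rightarrow> bool" where
  "isometric_embedding A dA B dB f \<longleftrightarrow>
     f ` A \<subseteq> B \<and> (\<forall>x\<in>A. \<forall>y\<in>A. dB (f x) (f y) = dA x y)"

definition isometric ::
  "'a set \<Rightarrow> ('a \<Rightarrow> 'a \<Rightarrow> real) \<Rightarrow> 'b set \<Rightarrow> ('b \<Rightarrow> 'b \<Rightarrow> real) \<Rightarrow> bool" where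
  "isometric A dA B dB \<longleftrightarrow> (\<exists>f. isometric_embedding A dA B dB f \<and> f ` A = B)"

text \<open>Universal Urysohn space: separable complete metric space with the finite
  extension property. Every finite metric space is isometric to one whose carrier is a
  finite set of natural numbers, so finite metric spaces are taken with carrier in nat.\<close>
definition urysohn_space :: "'b set \<Rightarrow> ('b \<Rightarrow> 'b \<Rightarrow> real) \<Rightarrow> bool" where
  "urysohn_space U dU \<longleftrightarrow>
     Metric_space U dU \<and>
     Metric_space.mcomplete U dU \<and>
     separable_space (Metric_space.mtopology U dU) \<and>
     (\<forall>(A::nat set) dA B f.
        finite A \<and> Metric_space A dA \<and> B \<subseteq> A \<and> isometric_embedding B dA U dU f \<longrightarrow>
        (\<exists>g. isometric_embedding A dA U dU g \<and> (\<forall>x\<in>B. g x = f x)))"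

definition function_system :: "'a set \<Rightarrow> ('a \<Rightarrow> 'a \<Rightarrow> real) \<Rightarrow> ('a \<Rightarrow> 'a) set \<Rightarrow> bool" where
  "function_system X d F \<longleftrightarrow> finite F \<and>
     (\<forall>f\<in>F. continuous_map (Metric_space.mtopology X d) (Metric_space.mtopology X d) f)"

definition fs_image :: "('a \<Rightarrow> 'a) set \<Rightarrow> 'a set \<Rightarrow> 'a set" where
  "fs_image F K = (\<Union>f\<in>F. f ` K)"

definition hausdorff_dist :: "('a \<Rightarrow> 'a \<Rightarrow> real) \<Rightarrow> 'a set \<Rightarrow> 'a set \<Rightarrow> real" where
  "hausdorff_dist d A B =
     max (SUP x\<in>A. INF y\<in>B. d x y) (SUP y\<in>B. INF x\<in>A. d x y)"

definition attractor :: "'a set \<Rightarrow> ('a \<Rightarrow> 'a \<Rightarrow> real) \<Rightarrow> ('a \<Rightarrow> 'a) set \<Rightarrow> 'a set \<Rightarrow> bool" where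
  "attractor X d F A \<longleftrightarrow>
     A \<noteq> {} \<and> compactin (Metric_space.mtopology X d) A \<and>
     fs_image F A = A \<and>
     (\<forall>K. K \<noteq> {} \<and> compactin (Metric_space.mtopology X d) K \<longrightarrow>
          (\<lambda>n. hausdorff_dist d ((fs_image F ^^ n) K) A) \<longlonglongrightarrow> 0)"

definition rakotch_contraction ::
  "'a set \<Rightarrow> ('a \<Rightarrow> 'a \<Rightarrow> real) \<Rightarrow> 'b set \<Rightarrow> ('b \<Rightarrow> 'b \<Rightarrow> real) \<Rightarrow> ('a \<Rightarrow> 'b) \<Rightarrow> bool" where
  "rakotch_contraction X dX Y dY f \<longleftrightarrow>
     f ` X \<subseteq> Y \<and>
     (\<exists>\<phi>::real \<Rightarrow> real.
        (\<forall>t\<ge>0. \<phi> t \<ge> 0) \<and>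
        (\<forall>x\<in>X. \<forall>x'\<in>X. dY (f x) (f x') \<le> \<phi> (dX x x')) \<and>
        (\<forall>a>0. \<exists>c<1. \<forall>t>a. \<phi> t / t \<le> c))"

definition banach_contraction ::
  "'a set \<Rightarrow> ('a \<Rightarrow> 'a \<Rightarrow> real) \<Rightarrow> 'b set \<Rightarrow> ('b \<Rightarrow> 'b \<Rightarrow> real) \<Rightarrow> ('a \<Rightarrow> 'b) \<Rightarrow> bool" where
  "banach_contraction X dX Y dY f \<longleftrightarrow>
     f ` X \<subseteq> Y \<and>
     (\<exists>L<1. \<forall>x\<in>X. \<forall>x'\<in>X. dY (f x) (f x') \<le> L * dX x x')"

definition rakotch_fractal :: "'a set \<Rightarrow> ('a \<Rightarrow> 'a \<Rightarrow> real) \<Rightarrow> bool" where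
  "rakotch_fractal X d \<longleftrightarrow>
     compact_space (Metric_space.mtopology X d) \<and>
     (\<exists>F. function_system X d F \<and> (\<forall>f\<in>F. rakotch_contraction X d X d f) \<and>
          X = fs_image F X)"

definition banach_fractal :: "'a set \<Rightarrow> ('a \<Rightarrow> 'a \<Rightarrow> real) \<Rightarrow> bool" where
  "banach_fractal X d \<longleftrightarrow>
     compact_space (Metric_space.mtopology X d) \<and>
     (\<exists>F. function_system X d F \<and> (\<forall>f\<in>F. banach_contraction X d X d f) \<and>
          X = fs_image F X)"

end

theory Submission
  imports Defs
begin

text \<open>A Rakotch contraction is dominated by a monotone subadditive modulus \<open>w\<close> with the same
  Rakotch property. If a map \<open>f\<close> with modulus \<open>w\<close> is defined on a totally bounded set \<open>A\<close> and \<open>x\<close>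
  is a new point, subadditivity of \<open>w\<close> makes \<open>h z = (INF a\<in>A. d z (f a) + w (d x a))\<close> a Katetov
  function. The Urysohn space realizes Katetov functions on totally bounded sets, as limits of
  realizations on finite nets, and a point realizing \<open>h\<close> is an admissible value at \<open>x\<close>. Adding the
  points of a countable dense set one by one and passing to the closure extends \<open>f\<close> to the whole
  space with the same modulus; the same extension argument embeds the fractal isometrically. A
  compact invariant set of a finite system of Rakotch contractions is its attractor, because above
  any positive scale the system contracts distances by a constant factor.\<close>

subsection \<open>Moduli of continuity\<close>

locale modulus_of_continuity =
  fixes w :: "real \<Rightarrow> real"
  assumes zero: "w 0 = 0"
    and mono: "\<And>s t. 0 \<le> s \<Longrightarrow> s \<le> t \<Longrightarrow> w s \<le> w t"
    and subadditive: "\<And>s t. 0 \<le> s \<Longrightarrow> 0 \<le> t \<Longrightarrow> w (s + t) \<le> w s + w t"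
    and tendsto_zero: "(w \<longlongrightarrow> 0) (at_right 0)"
begin

lemma nonneg: "0 \<le> t \<Longrightarrow> 0 \<le> w t"
  using mono[of 0 t] zero by simp

lemma small_near_zero:
  assumes "0 < e"
  obtains \<delta> where "0 < \<delta>" and "\<And>t. 0 \<le> t \<Longrightarrow> t < \<delta> \<Longrightarrow> w t < e"
proof -
  obtain \<delta> where "0 < \<delta>" and \<delta>: "\<And>t. 0 < t \<Longrightarrow> t < \<delta> \<Longrightarrow> w t < e"
    using order_tendstoD(2)[OF tendsto_zero assms] unfolding eventually_at_right_field by blast
  moreover have "w t < e" if "0 \<le> t" "t < \<delta>" for t
    using \<delta>[of t] zero assms that by (cases "t = 0") auto
  ultimately show ?thesis using that by blast
qed

lemma continuous_on_nonneg: "continuous_on {0..} w"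
  unfolding continuous_on_iff
proof (intro ballI allI impI)
  have increment: "w t - w s \<le> w (t - s)" if "0 \<le> s" "s \<le> t" for s t
    using subadditive[of s "t - s"] that by simp
  fix s e :: real
  assume "s \<in> {0..}" "0 < e"
  obtain \<delta> where "0 < \<delta>" and \<delta>: "\<And>t. 0 \<le> t \<Longrightarrow> t < \<delta> \<Longrightarrow> w t < e"
    using small_near_zero[OF \<open>0 < e\<close>] by metis
  have "dist (w t) (w s) < e" if "t \<in> {0..}" "dist t s < \<delta>" for t
    using increment[of s t] increment[of t s] \<delta>[of "\<bar>t - s\<bar>"] mono[of s t] mono[of t s]
      \<open>s \<in> {0..}\<close> that
    by (cases "s \<le> t") (auto simp: dist_real_def abs_if)
  with \<open>0 < \<delta>\<close> show "\<exists>\<delta>>0. \<forall>t\<in>{0..}. dist t s < \<delta> \<longrightarrow> dist (w t) (w s) < e" by blast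
qed

end

definition rakotch_condition :: "(real \<Rightarrow> real) \<Rightarrow> bool" where
  "rakotch_condition \<phi> \<longleftrightarrow> (\<forall>a>0. \<exists>c<1. \<forall>t>a. \<phi> t / t \<le> c)"

lemma rakotch_conditionE:
  assumes "rakotch_condition \<phi>" and "0 < a"
  obtains c where "0 \<le> c" "c < 1" "\<And>t. a < t \<Longrightarrow> \<phi> t \<le> c * t"
proof -
  obtain c where "c < 1" and c: "\<And>t. a < t \<Longrightarrow> \<phi> t / t \<le> c"
    using assms unfolding rakotch_condition_def by blast
  have "\<phi> t \<le> max 0 c * t" if "a < t" for t
  proof -
    have "\<phi> t \<le> c * t"
      using c[OF that] \<open>0 < a\<close> that by (simp add: divide_le_eq)
    also have "\<dots> \<le> max 0 c * t"
      using \<open>0 < a\<close> that by (intro mult_right_mono) auto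
    finally show ?thesis .
  qed
  with \<open>c < 1\<close> show ?thesis using that[of "max 0 c"] by simp
qed

lemma rakotch_condition_le:
  assumes "rakotch_condition \<phi>" and "0 < t"
  shows "\<phi> t \<le> t"
proof -
  obtain c where "0 \<le> c" "c < 1" and c: "\<And>s. t / 2 < s \<Longrightarrow> \<phi> s \<le> c * s"
    using rakotch_conditionE[OF assms(1), of "t / 2"] \<open>0 < t\<close> by auto
  have "\<phi> t \<le> c * t" using c \<open>0 < t\<close> by simp
  also have "\<dots> \<le> t" using \<open>c < 1\<close> \<open>0 < t\<close> by simp
  finally show ?thesis .
qed

locale rakotch_modulus = modulus_of_continuity +
  assumes rakotch: "rakotch_condition w"

lemma rakotch_modulusI:
  assumes "w 0 = 0"
    and "\<And>s t. 0 \<le> s \<Longrightarrow> s \<le> t \<Longrightarrow> w s \<le> w t"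
    and "\<And>s t. 0 \<le> s \<Longrightarrow> 0 \<le> t \<Longrightarrow> w (s + t) \<le> w s + w t"
    and "rakotch_condition w"
  shows "rakotch_modulus w"
proof
  show "(w \<longlongrightarrow> 0) (at_right 0)"
  proof (rule tendsto_sandwich)
    show "\<forall>\<^sub>F t in at_right 0. 0 \<le> w t"
      using assms(1) assms(2)[of 0] by (auto simp: eventually_at_right_field intro: exI[of _ 1])
    show "\<forall>\<^sub>F t in at_right 0. w t \<le> t"
      using rakotch_condition_le[OF assms(4)]
      by (auto simp: eventually_at_right_field intro: exI[of _ 1])
  qed (auto intro: tendsto_eq_intros)
qed fact+

definition banach_modulus :: "(real \<Rightarrow> real) \<Rightarrow> bool" where
  "banach_modulus w \<longleftrightarrow> (\<exists>L. 0 \<le> L \<and> L < 1 \<and> w = (*) L)"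

lemma banach_modulus_imp_rakotch_modulus:
  assumes "banach_modulus w"
  shows "rakotch_modulus w"
  using assms unfolding banach_modulus_def
  by (auto intro!: rakotch_modulusI simp: mult_left_mono distrib_left rakotch_condition_def)

definition affine_envelope :: "'i set \<Rightarrow> ('i \<Rightarrow> real) \<Rightarrow> ('i \<Rightarrow> real) \<Rightarrow> real \<Rightarrow> real" where
  "affine_envelope I p q t = (INF i\<in>I. p i + q i * t)"

context
  fixes I :: "'i set" and p q :: "'i \<Rightarrow> real"
  assumes nonempty: "I \<noteq> {}"
    and intercept_nonneg: "\<And>i. i \<in> I \<Longrightarrow> 0 \<le> p i"
    and slope_nonneg: "\<And>i. i \<in> I \<Longrightarrow> 0 \<le> q i"
begin

lemma affine_envelope_greatest:
  assumes "\<And>i. i \<in> I \<Longrightarrow> b \<le> p i + q i * t"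
  shows "b \<le> affine_envelope I p q t"
  unfolding affine_envelope_def using nonempty assms by (rule cINF_greatest)

lemma affine_envelope_lower:
  assumes "i \<in> I" "0 \<le> t"
  shows "affine_envelope I p q t \<le> p i + q i * t"
  unfolding affine_envelope_def using assms intercept_nonneg slope_nonneg
  by (intro cINF_lower bdd_belowI2[of _ 0]) auto

lemma affine_envelope_mono:
  assumes "0 \<le> s" "s \<le> t"
  shows "affine_envelope I p q s \<le> affine_envelope I p q t"
proof (rule affine_envelope_greatest)
  fix i assume "i \<in> I"
  then have "affine_envelope I p q s \<le> p i + q i * s"
    using \<open>0 \<le> s\<close> by (rule affine_envelope_lower)
  also have "\<dots> \<le> p i + q i * t"
    using \<open>s \<le> t\<close> slope_nonneg[OF \<open>i \<in> I\<close>] by (simp add: mult_left_mono)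
  finally show "affine_envelope I p q s \<le> p i + q i * t" .
qed

lemma affine_envelope_subadditive:
  assumes "0 \<le> s" "0 \<le> t"
  shows "affine_envelope I p q (s + t) \<le> affine_envelope I p q s + affine_envelope I p q t"
proof -
  have pairwise: "affine_envelope I p q (s + t) \<le> (p i + q i * s) + (p j + q j * t)"
    if "i \<in> I" "j \<in> I" for i j
  proof -
    define k where "k = (if q i \<le> q j then i else j)"
    have k: "k \<in> I" "p k \<le> p i + p j" "q k \<le> q i" "q k \<le> q j"
      using that intercept_nonneg by (auto simp: k_def)
    have "affine_envelope I p q (s + t) \<le> p k + q k * (s + t)"
      using k(1) assms by (intro affine_envelope_lower) auto
    also have "\<dots> = p k + q k * s + q k * t" by (simp add: distrib_left)
    also have "\<dots> \<le> (p i + p j) + q i * s + q j * t"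
      using k assms by (intro add_mono mult_right_mono)
    finally show ?thesis by simp
  qed
  have "affine_envelope I p q (s + t) - (p i + q i * s) \<le> affine_envelope I p q t"
    if "i \<in> I" for i
    using pairwise[OF that] by (intro affine_envelope_greatest) (simp add: algebra_simps)
  then have "affine_envelope I p q (s + t) - affine_envelope I p q t \<le> affine_envelope I p q s"
    by (intro affine_envelope_greatest) (simp add: algebra_simps)
  then show ?thesis by simp
qed

end

lemma rakotch_condition_affine_envelope:
  assumes c: "\<And>a. 0 < a \<Longrightarrow> 0 \<le> c a" "\<And>a. 0 < a \<Longrightarrow> c a < 1"
  shows "rakotch_condition (affine_envelope {0<..} (\<lambda>a. a * (1 - c a)) c)"
    (is "rakotch_condition ?w")
  unfolding rakotch_condition_def
proof (intro allI impI)
  fix a :: real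
  assume "0 < a"
  define b where "b = c (a / 2)"
  have b: "0 \<le> b" "b < 1" using c[of "a / 2"] \<open>0 < a\<close> by (auto simp: b_def)
  have "?w t / t \<le> (1 + b) / 2" if "a < t" for t
  proof -
    have "?w t \<le> a / 2 * (1 - b) + b * t"
      unfolding b_def using \<open>0 < a\<close> \<open>a < t\<close> c
      by (intro affine_envelope_lower) (auto simp: less_imp_le)
    also have "\<dots> \<le> t / 2 * (1 - b) + b * t"
      using \<open>a < t\<close> b by (intro add_right_mono mult_right_mono) auto
    also have "\<dots> = (1 + b) / 2 * t" by (simp add: field_simps)
    finally show ?thesis using \<open>0 < a\<close> \<open>a < t\<close> by (simp add: divide_le_eq)
  qed
  moreover have "(1 + b) / 2 < 1" using b by simp
  ultimately show "\<exists>k<1. \<forall>t>a. ?w t / t \<le> k" by blast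
qed

lemma rakotch_modulus_affine_envelope:
  assumes c: "\<And>a. 0 < a \<Longrightarrow> 0 \<le> c a" "\<And>a. 0 < a \<Longrightarrow> c a < 1"
  shows "rakotch_modulus (affine_envelope {0<..} (\<lambda>a. a * (1 - c a)) c)" (is "rakotch_modulus ?w")
proof (rule rakotch_modulusI)
  have intercept: "0 \<le> a * (1 - c a)" if "a \<in> {0<..}" for a
    using c(2)[of a] that by simp
  have slope: "0 \<le> c a" if "a \<in> {0<..}" for a
    using c(1) that by simp
  have "?w 0 \<le> 0 + e" if "0 < e" for e
  proof -
    have "?w 0 \<le> e * (1 - c e) + c e * 0"
      using that by (intro affine_envelope_lower intercept slope) auto
    also have "\<dots> \<le> 0 + e" using c[OF that] that by (simp add: algebra_simps)
    finally show ?thesis .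
  qed
  then have "?w 0 \<le> 0" by (rule field_le_epsilon)
  moreover have "0 \<le> ?w 0"
    using intercept by (intro affine_envelope_greatest slope) auto
  ultimately show "?w 0 = 0" by simp
  show "?w s \<le> ?w t" if "0 \<le> s" "s \<le> t" for s t
    using that by (intro affine_envelope_mono intercept slope) auto
  show "?w (s + t) \<le> ?w s + ?w t" if "0 \<le> s" "0 \<le> t" for s t
    using that by (intro affine_envelope_subadditive intercept slope) auto
  show "rakotch_condition ?w"
    using c by (rule rakotch_condition_affine_envelope)
qed

text \<open>The line of slope \<open>c a\<close> through \<open>(a, a)\<close> lies above \<open>\<phi>\<close> because \<open>\<phi> t \<le> t\<close> up to \<open>a\<close> and
  \<open>\<phi> t \<le> c a * t\<close> beyond.\<close>
lemma rakotch_condition_imp_modulus: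
  assumes "rakotch_condition \<phi>"
  obtains w where "rakotch_modulus w" and "\<And>t. 0 < t \<Longrightarrow> \<phi> t \<le> w t"
proof -
  have "\<forall>a. \<exists>c. 0 < a \<longrightarrow> 0 \<le> c \<and> c < 1 \<and> (\<forall>t>a. \<phi> t \<le> c * t)"
    using rakotch_conditionE[OF assms] by metis
  then obtain c where c: "\<And>a. 0 < a \<Longrightarrow> 0 \<le> c a" "\<And>a. 0 < a \<Longrightarrow> c a < 1"
    and \<phi>: "\<And>a t. 0 < a \<Longrightarrow> a < t \<Longrightarrow> \<phi> t \<le> c a * t"
    by metis
  have line: "\<phi> t \<le> a * (1 - c a) + c a * t" if "0 < a" "0 < t" for a t
  proof (cases "a < t")
    case True
    have "0 \<le> a * (1 - c a)" using c(2)[OF \<open>0 < a\<close>] \<open>0 < a\<close> by simp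
    with \<phi>[OF \<open>0 < a\<close> True] show ?thesis by simp
  next
    case False
    have "\<phi> t \<le> t * (1 - c a) + c a * t"
      using rakotch_condition_le[OF assms \<open>0 < t\<close>] by (simp add: algebra_simps)
    also have "\<dots> \<le> a * (1 - c a) + c a * t"
      using False c(2)[OF \<open>0 < a\<close>] by (intro add_right_mono mult_right_mono) auto
    finally show ?thesis .
  qed
  show ?thesis
  proof
    show "rakotch_modulus (affine_envelope {0<..} (\<lambda>a. a * (1 - c a)) c)"
      using c by (rule rakotch_modulus_affine_envelope)
    show "\<phi> t \<le> affine_envelope {0<..} (\<lambda>a. a * (1 - c a)) c t" if "0 < t" for t
      unfolding affine_envelope_def using line that by (intro cINF_greatest) auto
  qed
qed

subsection \<open>Extension of maps with controlled distances\<close>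

text \<open>\<open>R\<close> relates the distance of two points to the distance of their images; \<open>Id\<close> gives the
  isometric embeddings and \<open>modulus_relation w\<close> the maps with modulus of continuity \<open>w\<close>.\<close>
definition controlled_map ::
  "(real \<times> real) set \<Rightarrow> 'a set \<Rightarrow> ('a \<Rightarrow> 'a \<Rightarrow> real) \<Rightarrow> 'b set \<Rightarrow> ('b \<Rightarrow> 'b \<Rightarrow> real) \<Rightarrow>
    ('a \<Rightarrow> 'b) \<Rightarrow> bool" where
  "controlled_map R A dA B dB f \<longleftrightarrow>
     f ` A \<subseteq> B \<and> (\<forall>x\<in>A. \<forall>y\<in>A. (dA x y, dB (f x) (f y)) \<in> R)"

lemma controlled_map_Id_iff:
  "controlled_map Id A dA B dB f \<longleftrightarrow> isometric_embedding A dA B dB f"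
  unfolding controlled_map_def isometric_embedding_def by auto

definition modulus_relation :: "(real \<Rightarrow> real) \<Rightarrow> (real \<times> real) set" where
  "modulus_relation w = {(s, t). 0 \<le> s \<and> t \<le> w s}"

lemma (in Metric_space) controlled_map_modulus_iff:
  "controlled_map (modulus_relation w) A d B dB f \<longleftrightarrow>
     f ` A \<subseteq> B \<and> (\<forall>x\<in>A. \<forall>y\<in>A. dB (f x) (f y) \<le> w (d x y))"
  unfolding controlled_map_def modulus_relation_def by simp

definition distance_control :: "(real \<times> real) set \<Rightarrow> bool" where
  "distance_control R \<longleftrightarrow>
     closed R \<and> (0, 0) \<in> R \<and> (\<forall>e>0. \<exists>\<delta>>0. \<forall>s t. (s, t) \<in> R \<longrightarrow> s < \<delta> \<longrightarrow> t < e)"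

lemma distance_control_Id: "distance_control Id"
proof -
  have "closed (Id :: real rel)"
    using closed_diagonal[where 'a = real] by (simp add: Id_def full_SetCompr_eq)
  then show ?thesis unfolding distance_control_def by auto
qed

lemma (in modulus_of_continuity) distance_control_modulus: "distance_control (modulus_relation w)"
  unfolding distance_control_def
proof (intro conjI allI impI)
  have "continuous_on ({0..} \<times> UNIV) (\<lambda>p. w (fst p) - snd p)"
    by (intro continuous_intros continuous_on_compose2[OF continuous_on_nonneg]) auto
  moreover have "closed ({0..} \<times> UNIV :: (real \<times> real) set)"
    by (intro closed_Times) auto
  ultimately have "closed (({0..} \<times> UNIV) \<inter> (\<lambda>p. w (fst p) - snd p) -` {0..})"
    by (intro continuous_closed_preimage) auto
  also have "({0..} \<times> UNIV) \<inter> (\<lambda>p. w (fst p) - snd p) -` {0..} = modulus_relation w"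
    by (auto simp: modulus_relation_def)
  finally show "closed (modulus_relation w)" .
  show "(0, 0) \<in> modulus_relation w" by (simp add: modulus_relation_def zero)
  show "\<exists>\<delta>>0. \<forall>s t. (s, t) \<in> modulus_relation w \<longrightarrow> s < \<delta> \<longrightarrow> t < e" if "0 < e" for e
    using small_near_zero[OF that] unfolding modulus_relation_def
    by (metis (lifting) case_prodD mem_Collect_eq order_le_less_trans)
qed

lemma finite_to_nat_on_less:
  assumes "countable D"
  shows "finite {z \<in> D. to_nat_on D z < n}"
proof (rule finite_imageD)
  show "finite (to_nat_on D ` {z \<in> D. to_nat_on D z < n})"
    by (rule finite_subset[of _ "{..<n}"]) auto
  show "inj_on (to_nat_on D) {z \<in> D. to_nat_on D z < n}"
    using inj_on_to_nat_on[OF assms] by (rule inj_on_subset) auto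
qed

context Metric_space12
begin

lemma controlled_map_imp_uniformly_continuous:
  assumes "distance_control R" and "controlled_map R A d1 M2 d2 f"
  shows "uniformly_continuous_map (submetric M1.Self A) M2.Self f"
  unfolding uniformly_continuous_map_def
proof (intro conjI allI impI)
  show "f \<in> mspace (submetric M1.Self A) \<rightarrow> mspace M2.Self"
    using assms(2) unfolding controlled_map_def by auto
  fix e :: real
  assume "0 < e"
  then obtain \<delta> where "0 < \<delta>" "\<And>s t. (s, t) \<in> R \<Longrightarrow> s < \<delta> \<Longrightarrow> t < e"
    using assms(1) unfolding distance_control_def by blast
  with assms(2) show "\<exists>\<delta>>0. \<forall>x\<in>mspace (submetric M1.Self A). \<forall>y\<in>mspace (submetric M1.Self A).
      mdist (submetric M1.Self A) y x < \<delta> \<longrightarrow> mdist M2.Self (f y) (f x) < e"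
    unfolding controlled_map_def
    by (intro exI[of _ \<delta>])
      (metis IntD1 M1.mdist_Self M2.mdist_Self mdist_submetric mspace_submetric)
qed

lemma controlled_map_imp_mtotally_bounded_image:
  assumes "distance_control R" and "controlled_map R A d1 M2 d2 f" and "M1.mtotally_bounded A"
  shows "M2.mtotally_bounded (f ` A)"
proof -
  have "Cauchy_continuous_map (submetric M1.Self A) M2.Self f"
    using assms(1,2)
    by (intro uniformly_imp_Cauchy_continuous_map controlled_map_imp_uniformly_continuous)
  moreover have "Metric_space.mtotally_bounded A d1 A" "A \<subseteq> M1"
    using assms(3) M1.mtotally_bounded_absolute by auto
  ultimately show ?thesis
    using mtotally_bounded_Cauchy_continuous_image[of "submetric M1.Self A" M2.Self f A]
    by (simp add: Int_absorb2)
qed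

lemma controlled_map_closure:
  assumes "closed R" and f: "continuous_map M1.mtopology M2.mtopology f"
    and "controlled_map R S d1 M2 d2 f" and dense: "M1.mtopology closure_of S = M1"
  shows "controlled_map R M1 d1 M2 d2 f"
proof -
  define X where "X = prod_topology M1.mtopology M1.mtopology"
  define \<Phi> where "\<Phi> = (\<lambda>(x, y). (d1 x y, d2 (f x) (f y)))"
  have proj: "continuous_map X M1.mtopology fst" "continuous_map X M1.mtopology snd"
    unfolding X_def by (rule continuous_map_fst continuous_map_snd)+
  note f_proj = continuous_map_compose[OF proj(1) f, unfolded o_def]
    continuous_map_compose[OF proj(2) f, unfolded o_def]
  have "continuous_map X euclideanreal (\<lambda>p. d1 (fst p) (snd p))"
    using continuous_map_mdist[of X M1.Self] proj by (simp add: mtopology_of_def)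
  moreover have "continuous_map X euclideanreal (\<lambda>p. d2 (f (fst p)) (f (snd p)))"
    using continuous_map_mdist[of X M2.Self] f_proj by (simp add: mtopology_of_def)
  ultimately have "continuous_map X euclidean \<Phi>"
    unfolding \<Phi>_def case_prod_unfold continuous_map_atin
    by (simp add: limitin_canonical_iff tendsto_Pair)
  then have "closedin X {p \<in> topspace X. \<Phi> p \<in> R}"
    using \<open>closed R\<close> by (simp add: closedin_continuous_map_preimage)
  then have "\<Phi> (x, y) \<in> R" if "x \<in> M1" "y \<in> M1" for x y
  proof (rule forall_in_closure_of[rotated 2])
    show "(x, y) \<in> X closure_of (S \<times> S)"
      using that dense by (simp add: X_def closure_of_Times)
    show "\<Phi> p \<in> R" if "p \<in> S \<times> S" for p
      using that \<open>controlled_map R S d1 M2 d2 f\<close> unfolding \<Phi>_def controlled_map_def by auto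
  qed
  moreover have "f ` M1 \<subseteq> M2"
    using continuous_map_image_subset_topspace[OF f] by simp
  ultimately show ?thesis unfolding controlled_map_def \<Phi>_def by simp
qed

lemma controlled_map_extension_from_dense:
  assumes "M2.mcomplete" and "distance_control R"
    and f: "controlled_map R S d1 M2 d2 f" and dense: "M1.mtopology closure_of S = M1"
  obtains g where "controlled_map R M1 d1 M2 d2 g" and "\<And>x. x \<in> S \<Longrightarrow> g x = f x"
proof -
  have "mcomplete_of M2.Self" using assms(1) by (simp add: mcomplete_of_def)
  then obtain g
    where g: "uniformly_continuous_map
        (submetric M1.Self (mtopology_of M1.Self closure_of S)) M2.Self g"
      and gf: "\<And>x. x \<in> S \<Longrightarrow> g x = f x"
    using controlled_map_imp_uniformly_continuous[OF assms(2) f]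
      uniformly_continuous_map_extends_to_closure_of by blast
  have "continuous_map M1.mtopology M2.mtopology g"
    using uniformly_continuous_imp_continuous_map[OF g] dense
    by (simp add: mtopology_of_def)
  moreover have "controlled_map R S d1 M2 d2 g"
    using f gf unfolding controlled_map_def by auto
  moreover have "closed R" using assms(2) by (simp add: distance_control_def)
  ultimately have "controlled_map R M1 d1 M2 d2 g"
    using dense controlled_map_closure by blast
  then show ?thesis using gf that by blast
qed

lemma controlled_map_override_on:
  fixes rank :: "'a \<Rightarrow> nat"
  assumes "(0, 0) \<in> R" and "S \<subseteq> M1" and "A \<inter> S = {}" and "inj_on rank S"
    and f: "controlled_map R A d1 M2 d2 f" and "g ` S \<subseteq> M2"
    and earlier: "\<And>x z. x \<in> S \<Longrightarrow> z \<in> A \<union> {z \<in> S. rank z < rank x} \<Longrightarrow>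
      (d1 x z, d2 (g x) (override_on g f A z)) \<in> R"
  shows "controlled_map R (A \<union> S) d1 M2 d2 (override_on g f A)" (is "controlled_map _ _ _ _ _ ?h")
proof -
  have h: "?h x = (if x \<in> A then f x else g x)" for x
    by (simp add: override_on_def)
  have notin: "x \<notin> A" if "x \<in> S" for x using that \<open>A \<inter> S = {}\<close> by blast
  have cross: "(d1 x y, d2 (?h x) (?h y)) \<in> R" if "x \<in> S" "y \<in> A" for x y
    using earlier[of x y] that notin by simp
  then have "(d1 y x, d2 (?h y) (?h x)) \<in> R" if "x \<in> S" "y \<in> A" for x y
    using that by (metis M1.commute M2.commute)
  moreover have "(d1 x y, d2 (?h x) (?h y)) \<in> R" if "x \<in> S" "y \<in> S" for x y
  proof (cases "rank x" "rank y" rule: linorder_cases)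
    case less
    with earlier[of y x] that notin show ?thesis by (simp add: M1.commute M2.commute)
  next
    case equal
    with \<open>inj_on rank S\<close> that have "x = y" by (auto dest: inj_onD)
    moreover have "x \<in> M1" "?h x \<in> M2" using that notin assms(2,6) by (auto simp: h)
    ultimately show ?thesis using \<open>(0, 0) \<in> R\<close> by simp
  next
    case greater
    with earlier[of x y] that notin show ?thesis by simp
  qed
  moreover have "(d1 x y, d2 (?h x) (?h y)) \<in> R" if "x \<in> A" "y \<in> A" for x y
    using f that by (simp add: controlled_map_def)
  moreover have "?h ` (A \<union> S) \<subseteq> M2"
    using f \<open>g ` S \<subseteq> M2\<close> by (auto simp: h controlled_map_def)
  ultimately show ?thesis using cross unfolding controlled_map_def by blast
qed

text \<open>The points of \<open>D\<close> are added in the order of an enumeration; \<open>admissible g x y\<close> says that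
  \<open>y\<close> may be the value at \<open>x\<close> when \<open>f\<close> and \<open>g\<close> are the maps on \<open>A\<close> and on the points before \<open>x\<close>.\<close>
lemma controlled_map_countable_extension:
  assumes "countable D" and "D \<subseteq> M1" and "A \<inter> D = {}" and "(0, 0) \<in> R"
    and f: "controlled_map R A d1 M2 d2 f"
    and one_point: "\<And>B g z. finite B \<Longrightarrow> B \<subseteq> D \<Longrightarrow> controlled_map R (A \<union> B) d1 M2 d2 g \<Longrightarrow> z \<in> D \<Longrightarrow>
      \<exists>y\<in>M2. \<forall>x\<in>A \<union> B. (d1 z x, d2 y (g x)) \<in> R"
  obtains g where "controlled_map R (A \<union> D) d1 M2 d2 g" and "\<And>x. x \<in> A \<Longrightarrow> g x = f x"
proof -
  let ?ext = "\<lambda>g. override_on g f A"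
  define before where "before x = {z \<in> D. to_nat_on D z < to_nat_on D x}" for x
  define admissible where "admissible g x y \<longleftrightarrow>
      (x \<in> D \<longrightarrow> y \<in> M2 \<and> (\<forall>z\<in>A \<union> before x. (d1 x z, d2 y (?ext g z)) \<in> R))" for g x y
  have controlled: "controlled_map R (A \<union> S) d1 M2 d2 (?ext g)"
    if "S \<subseteq> D" and adm: "\<And>x. x \<in> S \<Longrightarrow> admissible g x (g x)" for S g
  proof (rule controlled_map_override_on[where rank = "to_nat_on D"])
    show "inj_on (to_nat_on D) S"
      using inj_on_to_nat_on[OF \<open>countable D\<close>] \<open>S \<subseteq> D\<close> by (rule inj_on_subset)
    show "g ` S \<subseteq> M2"
      using adm \<open>S \<subseteq> D\<close> unfolding admissible_def by blast
    show "(d1 x z, d2 (g x) (?ext g z)) \<in> R"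
      if "x \<in> S" "z \<in> A \<union> {z \<in> S. to_nat_on D z < to_nat_on D x}" for x z
      using adm[OF that(1)] that \<open>S \<subseteq> D\<close> unfolding admissible_def before_def by blast
  qed (use assms(2-5) \<open>S \<subseteq> D\<close> in auto)
  have "\<exists>g. \<forall>x. admissible g x (g x)"
  proof (rule dependent_wf_choice[of "inv_image less_than (to_nat_on D)"])
    show "admissible g x y = admissible h x y"
      if "\<And>z. (z, x) \<in> inv_image less_than (to_nat_on D) \<Longrightarrow> g z = h z" for g h x y
    proof -
      have "?ext g z = ?ext h z" if "z \<in> A \<union> before x" for z
        using that \<open>\<And>z. (z, x) \<in> inv_image less_than (to_nat_on D) \<Longrightarrow> g z = h z\<close>
        by (auto simp: before_def override_on_def)
      then show ?thesis by (simp add: admissible_def)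
    qed
    show "\<exists>y. admissible g x y"
      if "\<And>y. (y, x) \<in> inv_image less_than (to_nat_on D) \<Longrightarrow> admissible g y (g y)" for x g
    proof (cases "x \<in> D")
      case True
      have "finite (before x)" "before x \<subseteq> D"
        using finite_to_nat_on_less[OF \<open>countable D\<close>] by (auto simp: before_def)
      moreover have "controlled_map R (A \<union> before x) d1 M2 d2 (?ext g)"
        using that by (intro controlled) (auto simp: before_def)
      ultimately show ?thesis
        using one_point True unfolding admissible_def by blast
    qed (simp add: admissible_def)
  qed (rule wf_inv_image[OF wf_less_than])
  then obtain g where "\<And>x. admissible g x (g x)" by blast
  then have "controlled_map R (A \<union> D) d1 M2 d2 (?ext g)" by (intro controlled) auto
  then show ?thesis using that by simp
qed

proposition controlled_map_extension:
  assumes "separable_space M1.mtopology" and "M2.mcomplete" and "distance_control R"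
    and "M1.mtotally_bounded A" and f: "controlled_map R A d1 M2 d2 f"
    and one_point: "\<And>B g z. M1.mtotally_bounded B \<Longrightarrow> controlled_map R B d1 M2 d2 g \<Longrightarrow> z \<in> M1 \<Longrightarrow>
      \<exists>y\<in>M2. \<forall>x\<in>B. (d1 z x, d2 y (g x)) \<in> R"
  obtains g where "controlled_map R M1 d1 M2 d2 g" and "\<And>x. x \<in> A \<Longrightarrow> g x = f x"
proof -
  obtain D where D: "countable D" "D \<subseteq> M1" "M1.mtopology closure_of D = M1"
    using assms(1) unfolding separable_space_def by auto
  define E where "E = D - A"
  have E: "countable E" "E \<subseteq> M1" "A \<inter> E = {}"
    using D by (auto simp: E_def)
  have "A \<subseteq> M1" using assms(4) by (rule M1.mtotally_bounded_imp_subset)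
  have "(0, 0) \<in> R" using assms(3) by (simp add: distance_control_def)
  have "\<exists>y\<in>M2. \<forall>x\<in>A \<union> B. (d1 z x, d2 y (g x)) \<in> R"
    if "finite B" "B \<subseteq> E" "controlled_map R (A \<union> B) d1 M2 d2 g" "z \<in> E" for B g z
  proof -
    have "M1.mtotally_bounded (A \<union> B)"
      using assms(4) that(1,2) E(2)
      by (intro M1.mtotally_bounded_Un) (auto intro: M1.finite_imp_mtotally_bounded)
    with one_point that(3,4) E(2) show ?thesis by blast
  qed
  then obtain g where g: "controlled_map R (A \<union> E) d1 M2 d2 g" and gf: "\<And>x. x \<in> A \<Longrightarrow> g x = f x"
    using controlled_map_countable_extension[OF E \<open>(0, 0) \<in> R\<close> f] by metis
  have "M1.mtopology closure_of (A \<union> E) = M1"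
    using D(3) closure_of_mono[of D "A \<union> E" M1.mtopology]
      closure_of_subset_topspace[of M1.mtopology "A \<union> E"] by (auto simp: E_def)
  with assms(2,3) g obtain h where "controlled_map R M1 d1 M2 d2 h"
      and "\<And>x. x \<in> A \<union> E \<Longrightarrow> h x = g x"
    using controlled_map_extension_from_dense by metis
  with gf that show ?thesis by auto
qed

end

subsection \<open>Katetov functions and the Urysohn space\<close>

lemma isometric_embedding_inj_on:
  assumes "Metric_space A dA" and "isometric_embedding A dA B dB f" and "Metric_space B dB"
  shows "inj_on f A"
  using assms unfolding isometric_embedding_def
  by (intro inj_onI) (metis Metric_space.zero image_subset_iff)

context Metric_space
begin

definition katetov_on :: "'a set \<Rightarrow> ('a \<Rightarrow> real) \<Rightarrow> bool" where
  "katetov_on S h \<longleftrightarrow> (\<forall>x\<in>S. \<forall>y\<in>S. \<bar>h x - h y\<bar> \<le> d x y \<and> d x y \<le> h x + h y)"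

lemma katetov_onD:
  assumes "katetov_on S h" "x \<in> S" "y \<in> S"
  shows "\<bar>h x - h y\<bar> \<le> d x y" and "d x y \<le> h x + h y"
  using assms unfolding katetov_on_def by blast+

lemma katetov_on_subset: "katetov_on S h \<Longrightarrow> T \<subseteq> S \<Longrightarrow> katetov_on T h"
  unfolding katetov_on_def by blast

lemma katetov_on_nonneg: "katetov_on S h \<Longrightarrow> x \<in> S \<Longrightarrow> 0 \<le> h x"
  using katetov_onD(2)[of S h x x] nonneg[of x x] by linarith

lemma katetov_on_insert:
  assumes h: "katetov_on S h" and "y \<in> M" "y \<notin> S" "0 \<le> r"
    and r: "\<And>s. s \<in> S \<Longrightarrow> \<bar>h s - r\<bar> \<le> d s y" "\<And>s. s \<in> S \<Longrightarrow> d s y \<le> h s + r"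
  shows "katetov_on (insert y S) (h(y := r))"
proof -
  have "\<bar>r - h s\<bar> \<le> d y s" "d y s \<le> r + h s" if "s \<in> S" for s
    using r[OF that] commute[of s y] by auto
  then show ?thesis
    using assms katetov_onD[OF h] unfolding katetov_on_def by auto
qed

lemma katetov_on_abs_diff_le:
  assumes h: "katetov_on S h" and "S \<subseteq> M" "x \<in> S" "z \<in> S" "y \<in> M" and "d y x = h x"
  shows "\<bar>h z - d y z\<bar> \<le> 2 * d x z"
proof -
  have "\<bar>h x - h z\<bar> \<le> d x z" using katetov_onD(1)[OF h] assms(3,4) by blast
  moreover have "\<bar>d y x - d x z\<bar> \<le> d y z" "d y z \<le> d y x + d x z"
    using mdist_reverse_triangle[of y x z] triangle[of y x z] assms(2-5) by auto
  ultimately show ?thesis using \<open>d y x = h x\<close> by linarith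
qed

lemma katetov_on_INF:
  assumes "I \<noteq> {}" and p: "\<And>i. i \<in> I \<Longrightarrow> p i \<in> M"
    and r: "\<And>i j. i \<in> I \<Longrightarrow> j \<in> I \<Longrightarrow> d (p i) (p j) \<le> r i + r j"
  shows "katetov_on M (\<lambda>z. INF i\<in>I. d z (p i) + r i)" (is "katetov_on M ?h")
proof -
  have r_nonneg: "0 \<le> r i" if "i \<in> I" for i
    using r[OF that that] p[OF that] by simp
  have h_lower: "?h z \<le> d z (p i) + r i" if "i \<in> I" for z i
    using that r_nonneg by (intro cINF_lower bdd_belowI2[of _ 0]) auto
  have h_greatest: "b \<le> ?h z" if "\<And>i. i \<in> I \<Longrightarrow> b \<le> d z (p i) + r i" for b z
    using \<open>I \<noteq> {}\<close> that by (rule cINF_greatest)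
  have diff: "?h y - d y z \<le> ?h z" if "y \<in> M" "z \<in> M" for y z
  proof (rule h_greatest)
    show "?h y - d y z \<le> d z (p i) + r i" if "i \<in> I" for i
      using h_lower[OF that, of y] triangle[OF \<open>y \<in> M\<close> \<open>z \<in> M\<close> p[OF that]] by linarith
  qed
  have sum: "d y z \<le> ?h y + ?h z" if "y \<in> M" "z \<in> M" for y z
  proof -
    have pair: "d y z \<le> (d y (p i) + r i) + (d z (p j) + r j)" if "i \<in> I" "j \<in> I" for i j
      using r[OF that] triangle[of y "p i" z] triangle'[of "p i" "p j" z]
        p[OF that(1)] p[OF that(2)] \<open>y \<in> M\<close> \<open>z \<in> M\<close> by linarith
    have "d y z - (d y (p i) + r i) \<le> ?h z" if "i \<in> I" for i
      using pair[OF that] by (intro h_greatest) (simp add: algebra_simps)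
    then have "d y z - ?h z \<le> ?h y" by (intro h_greatest) (simp add: algebra_simps)
    then show ?thesis by simp
  qed
  show ?thesis
    unfolding katetov_on_def
  proof (intro ballI conjI)
    fix y z assume "y \<in> M" "z \<in> M"
    then show "\<bar>?h y - ?h z\<bar> \<le> d y z" "d y z \<le> ?h y + ?h z"
      using diff[of y z] diff[of z y] sum[of y z] commute[of y z] by linarith+
  qed
qed

lemma katetov_on_isometric_image:
  assumes "Metric_space Z dZ" and "S \<subseteq> Z" "x \<in> Z" and f: "isometric_embedding S dZ M d f"
  shows "katetov_on (f ` S) (\<lambda>z. dZ x (inv_into S f z))"
proof -
  interpret Z: Metric_space Z dZ by fact
  have dist: "d (f a) (f b) = dZ a b" if "a \<in> S" "b \<in> S" for a b
    using f that by (simp add: isometric_embedding_def)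
  have inv: "inv_into S f (f a) = a" if "a \<in> S" for a
    using isometric_embedding_inj_on[OF Z.subspace f Metric_space_axioms] \<open>S \<subseteq> Z\<close> that by simp
  have "\<bar>dZ x a - dZ x b\<bar> \<le> dZ a b" "dZ a b \<le> dZ x a + dZ x b" if "a \<in> S" "b \<in> S" for a b
    using that assms(2,3) Z.mdist_reverse_triangle[of a x b] Z.triangle''[of a x b]
    by (auto simp: Z.commute[of a x])
  then show ?thesis unfolding katetov_on_def by (auto simp: dist inv)
qed

lemma MCauchy_of_summable_dist:
  assumes "range y \<subseteq> M" and "summable a" and step: "\<And>n. d (y n) (y (Suc n)) \<le> a n"
  shows "MCauchy y"
  unfolding MCauchy_def
proof (intro conjI allI impI)
  have a: "0 \<le> a n" for n using step[of n] nonneg order_trans by blast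
  have yM: "y n \<in> M" for n using assms(1) by auto
  have tail: "d (y m) (y n) \<le> sum a {m..<n}" if "m \<le> n" for m n
    using that
  proof (induction n rule: dec_induct)
    case base
    show ?case using yM by simp
  next
    case (step n)
    have "d (y m) (y (Suc n)) \<le> d (y m) (y n) + d (y n) (y (Suc n))" using yM triangle by blast
    also have "\<dots> \<le> sum a {m..<n} + a n" using step assms(3) by (intro add_mono)
    also have "\<dots> = sum a {m..<Suc n}" using step by simp
    finally show ?case .
  qed
  fix e :: real
  assume "0 < e"
  then obtain N where N: "\<And>m n. N \<le> m \<Longrightarrow> norm (sum a {m..<n}) < e"
    using \<open>summable a\<close> unfolding summable_Cauchy by meson
  have "d (y m) (y n) < e" if "N \<le> m" "m \<le> n" for m n
    using tail[OF \<open>m \<le> n\<close>] N[OF \<open>N \<le> m\<close>, of n] by simp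
  then show "\<exists>N. \<forall>m n. N \<le> m \<longrightarrow> N \<le> n \<longrightarrow> d (y m) (y n) < e"
    by (metis commute nat_le_linear)
qed (rule assms(1))

end

text \<open>The absolute values are there because \<open>Metric_space\<close> requires the distance to be nonnegative
  outside the carrier as well.\<close>
fun one_point_dist ::
  "('a \<Rightarrow> 'a \<Rightarrow> real) \<Rightarrow> ('a \<Rightarrow> real) \<Rightarrow> 'a option \<Rightarrow> 'a option \<Rightarrow> real" where
  "one_point_dist d h None None = 0"
| "one_point_dist d h None (Some y) = \<bar>h y\<bar>"
| "one_point_dist d h (Some x) None = \<bar>h x\<bar>"
| "one_point_dist d h (Some x) (Some y) = d x y"

lemma (in Metric_space) Metric_space_one_point_dist:
  assumes h: "katetov_on S h" and "S \<subseteq> M" and pos: "\<And>s. s \<in> S \<Longrightarrow> 0 < h s"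
  shows "Metric_space (insert None (Some ` S)) (one_point_dist d h)"
proof
  show "0 \<le> one_point_dist d h x y" for x y
    by (cases x; cases y) auto
  show "one_point_dist d h x y = one_point_dist d h y x" for x y
    by (cases x; cases y) (auto simp: commute)
  have abs_h: "\<bar>h a\<bar> = h a" if "a \<in> S" for a using pos[OF that] by simp
  have lipschitz: "h a \<le> h b + d b a" "h a \<le> d a b + h b" if "a \<in> S" "b \<in> S" for a b
    using katetov_onD(1)[OF h that] commute[of a b] by auto
  have d_triangle: "d a c \<le> d a b + d b c" if "a \<in> S" "b \<in> S" "c \<in> S" for a b c
    using that \<open>S \<subseteq> M\<close> triangle by blast
  fix x y assume xy: "x \<in> insert None (Some ` S)" "y \<in> insert None (Some ` S)"
  then show "one_point_dist d h x y = 0 \<longleftrightarrow> x = y"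
    using \<open>S \<subseteq> M\<close> by (cases x; cases y) (auto simp: subset_iff dest: pos)
  fix z assume "z \<in> insert None (Some ` S)"
  with xy show "one_point_dist d h x z \<le> one_point_dist d h x y + one_point_dist d h y z"
    by (cases x; cases y; cases z)
      (auto simp: abs_h d_triangle lipschitz katetov_onD(2)[OF h] katetov_on_nonneg[OF h])
qed

locale Urysohn_space = Metric_space U d for U :: "'b set" and d +
  assumes urysohn: "urysohn_space U d"
begin

lemma complete: "mcomplete"
  using urysohn by (simp add: urysohn_space_def)

lemma separable: "separable_space mtopology"
  using urysohn by (simp add: urysohn_space_def)

lemma finite_extension:
  assumes "finite A" and "Metric_space A dA" and "B \<subseteq> A" and f: "isometric_embedding B dA U d f"
  obtains g where "isometric_embedding A dA U d g" and "\<And>x. x \<in> B \<Longrightarrow> g x = f x"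
proof -
  have extension_nat: "\<exists>g. isometric_embedding N e U d g \<and> (\<forall>x\<in>M. g x = f x)"
    if "finite N" "Metric_space N e" "M \<subseteq> N" "isometric_embedding M e U d f"
    for N M :: "nat set" and e f
    using urysohn that unfolding urysohn_space_def by blast
  interpret A: Metric_space A dA by fact
  obtain i :: "'a \<Rightarrow> nat" where i: "inj_on i A"
    using finite_imp_inj_to_nat_seg[OF \<open>finite A\<close>] by blast
  define j where "j = inv_into A i"
  have j: "j (i x) = x" if "x \<in> A" for x
    using i that by (simp add: j_def)
  define dN where "dN m n = dA (j m) (j n)" for m n
  have "Metric_space (i ` A) dN"
    by unfold_locales (auto simp: dN_def j A.commute intro: A.triangle)
  moreover have "isometric_embedding (i ` B) dN U d (f \<circ> j)"
    using f j \<open>B \<subseteq> A\<close> unfolding isometric_embedding_def dN_def by (auto simp: subset_iff)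
  ultimately obtain g where "isometric_embedding (i ` A) dN U d g" "\<forall>m\<in>i ` B. g m = (f \<circ> j) m"
    using extension_nat[OF finite_imageI[OF \<open>finite A\<close>] _ image_mono[OF \<open>B \<subseteq> A\<close>]] by metis
  then have "isometric_embedding A dA U d (g \<circ> i)" "\<And>x. x \<in> B \<Longrightarrow> (g \<circ> i) x = f x"
    using j \<open>B \<subseteq> A\<close> unfolding isometric_embedding_def dN_def by (auto simp: subset_iff)
  then show ?thesis using that by blast
qed

lemma katetov_realized_finite:
  assumes "finite S" and "S \<subseteq> U" and h: "katetov_on S h"
  obtains y where "y \<in> U" and "\<And>s. s \<in> S \<Longrightarrow> d y s = h s"
proof (cases "\<exists>s\<in>S. h s = 0")
  case True
  then obtain s where s: "s \<in> S" "h s = 0" by blast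
  then have "d s t = h t" if "t \<in> S" for t
    using katetov_onD[OF h s(1) that] by simp
  with s \<open>S \<subseteq> U\<close> that show ?thesis by blast
next
  case False
  with katetov_on_nonneg[OF h] have pos: "0 < h s" if "s \<in> S" for s
    using that by (metis less_eq_real_def)
  let ?A = "insert None (Some ` S)"
  have "isometric_embedding (Some ` S) (one_point_dist d h) U d the"
    using \<open>S \<subseteq> U\<close> by (auto simp: isometric_embedding_def)
  then obtain g where g: "isometric_embedding ?A (one_point_dist d h) U d g"
      and "\<And>x. x \<in> Some ` S \<Longrightarrow> g x = the x"
    using \<open>finite S\<close> finite_extension[OF _ Metric_space_one_point_dist[OF h \<open>S \<subseteq> U\<close> pos]]
    by (metis finite_imageI finite_insert subset_insertI)
  then have "g None \<in> U" "\<And>s. s \<in> S \<Longrightarrow> d (g None) s = h s"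
    using pos unfolding isometric_embedding_def by (force, fastforce)
  then show ?thesis by (rule that)
qed

text \<open>Prescribing the distance \<open>r\<close> to \<open>y\<close> extends \<open>h\<close> to a Katetov function unless \<open>d y s + h s \<le> r\<close>
  for some \<open>s\<close>, and then every point realizing \<open>h\<close> on \<open>S\<close> lies within \<open>r\<close> of \<open>y\<close>.\<close>
lemma katetov_realized_finite_near:
  assumes "finite S" and "S \<subseteq> U" and h: "katetov_on S h" and "y \<in> U" "0 \<le> r"
    and near: "\<And>s. s \<in> S \<Longrightarrow> \<bar>h s - d y s\<bar> \<le> r"
  obtains z where "z \<in> U" and "\<And>s. s \<in> S \<Longrightarrow> d z s = h s" and "d y z \<le> r"
proof (cases "\<exists>s\<in>S. d y s + h s \<le> r")
  case True
  then obtain s where s: "s \<in> S" "d y s + h s \<le> r" by blast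
  obtain z where z: "z \<in> U" "\<And>s. s \<in> S \<Longrightarrow> d z s = h s"
    using katetov_realized_finite assms(1-3) by metis
  have "d y z \<le> d y s + d z s" using triangle' s z \<open>y \<in> U\<close> \<open>S \<subseteq> U\<close> by blast
  also have "\<dots> \<le> r" using s z by simp
  finally show ?thesis using z that by blast
next
  case False
  then have far: "r < d y s + h s" if "s \<in> S" for s using that by force
  have "y \<notin> S" using far[of y] near[of y] \<open>y \<in> U\<close> by force
  have "katetov_on (insert y S) (h(y := r))"
  proof (rule katetov_on_insert)
    show "\<bar>h s - r\<bar> \<le> d s y" "d s y \<le> h s + r" if "s \<in> S" for s
      using far[OF that] near[OF that] commute[of s y] by linarith+
  qed fact+
  then obtain z where "z \<in> U" "\<And>s. s \<in> insert y S \<Longrightarrow> d z s = (h(y := r)) s"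
    using katetov_realized_finite[of "insert y S"] assms(1,2,4)
    by (metis finite_insert insert_subset)
  then have "z \<in> U" "\<And>s. s \<in> S \<Longrightarrow> d z s = h s" "d y z = r"
    using \<open>y \<notin> S\<close> commute[of y z] by fastforce+
  then show ?thesis using that by simp
qed

lemma katetov_realized_approximately:
  fixes r :: "nat \<Rightarrow> real"
  assumes "mtotally_bounded K" and h: "katetov_on K h" and r: "\<And>n. 0 < r n"
  obtains y where "range y \<subseteq> U" and "\<And>n k. k \<in> K \<Longrightarrow> \<bar>h k - d (y n) k\<bar> \<le> 2 * r n"
    and "\<And>n. d (y n) (y (Suc n)) \<le> 2 * r n"
proof -
  have "K \<subseteq> U" using assms(1) by (rule mtotally_bounded_imp_subset)
  have "\<forall>n. \<exists>N. finite N \<and> N \<subseteq> K \<and> K \<subseteq> (\<Union>x\<in>N. mball x (r n))"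
    using assms(1) r unfolding mtotally_bounded_def by blast
  then obtain N where N: "\<And>n. finite (N n)" "\<And>n. N n \<subseteq> K" "\<And>n. K \<subseteq> (\<Union>x\<in>N n. mball x (r n))"
    by metis
  have h_N: "katetov_on (N n) h" and N_U: "N n \<subseteq> U" for n
    using katetov_on_subset[OF h N(2)] N(2) \<open>K \<subseteq> U\<close> by auto
  define realizes where "realizes n y \<longleftrightarrow> y \<in> U \<and> (\<forall>k\<in>N n. d y k = h k)" for n y
  have near: "\<bar>h k - d y k\<bar> \<le> 2 * r n" if "realizes n y" "k \<in> K" for n y k
  proof -
    obtain x where x: "x \<in> N n" "d x k < r n" using N(3) \<open>k \<in> K\<close> by fastforce
    have "\<bar>h k - d y k\<bar> \<le> 2 * d x k"
      using h \<open>K \<subseteq> U\<close> _ \<open>k \<in> K\<close>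
      by (rule katetov_on_abs_diff_le) (use x that(1) N(2) in \<open>auto simp: realizes_def\<close>)
    also have "\<dots> \<le> 2 * r n" using x(2) by simp
    finally show ?thesis .
  qed
  have "\<exists>y. realizes 0 y"
    using katetov_realized_finite[OF N(1) N_U h_N] unfolding realizes_def by metis
  moreover have "\<exists>z. realizes (Suc n) z \<and> d y z \<le> 2 * r n" if "realizes n y" for n y
  proof -
    have "\<bar>h k - d y k\<bar> \<le> 2 * r n" if "k \<in> N (Suc n)" for k
      using near[OF \<open>realizes n y\<close>] that N(2) by blast
    moreover have "y \<in> U" "0 \<le> 2 * r n" using that r[of n] by (auto simp: realizes_def)
    ultimately show ?thesis
      using katetov_realized_finite_near[OF N(1) N_U h_N] unfolding realizes_def by metis
  qed
  ultimately obtain y where y: "\<And>n. realizes n (y n)" "\<And>n. d (y n) (y (Suc n)) \<le> 2 * r n"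
    using dependent_nat_choice[of realizes "\<lambda>n y z. d y z \<le> 2 * r n"] by metis
  show ?thesis
  proof (rule that)
    show "range y \<subseteq> U" using y(1) by (auto simp: realizes_def)
    show "\<bar>h k - d (y n) k\<bar> \<le> 2 * r n" if "k \<in> K" for n k using y(1) that by (rule near)
    show "d (y n) (y (Suc n)) \<le> 2 * r n" for n by (rule y(2))
  qed
qed

theorem katetov_realized_totally_bounded:
  assumes "mtotally_bounded K" and h: "katetov_on K h"
  shows "\<exists>y\<in>U. \<forall>k\<in>K. d y k = h k"
proof -
  define r :: "nat \<Rightarrow> real" where "r n = (1/2) ^ n" for n
  have "0 < r n" for n by (simp add: r_def)
  then obtain y where y: "range y \<subseteq> U" "\<And>n k. k \<in> K \<Longrightarrow> \<bar>h k - d (y n) k\<bar> \<le> 2 * r n"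
      "\<And>n. d (y n) (y (Suc n)) \<le> 2 * r n"
    using katetov_realized_approximately[OF assms] by metis
  have r: "summable (\<lambda>n. 2 * r n)"
    unfolding r_def by (intro summable_mult summable_geometric) simp
  then have "MCauchy y" using y(1,3) by (intro MCauchy_of_summable_dist)
  then obtain z where z: "limitin mtopology y z sequentially"
    using complete unfolding mcomplete_def by blast
  then have "z \<in> U" by (rule limitin_mspace)
  have "d z k = h k" if "k \<in> K" for k
  proof (rule LIMSEQ_unique)
    have "k \<in> U" using that mtotally_bounded_imp_subset[OF assms(1)] by blast
    then have "continuous_map mtopology euclideanreal (d k)"
      using continuous_on_mdist[of k Self] by (simp add: mtopology_of_def)
    then show "(\<lambda>n. d k (y n)) \<longlonglongrightarrow> d z k"
      using continuous_map_limit[OF _ z] by (fastforce simp: o_def commute[of z])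
    have "\<forall>n. norm (d k (y n) - h k) \<le> 2 * r n"
      using y(2)[OF that] by (simp add: commute[of k] abs_minus_commute)
    then have "(\<lambda>n. d k (y n) - h k) \<longlonglongrightarrow> 0"
      by (intro Lim_null_comparison[OF _ summable_LIMSEQ_zero[OF r]]) simp
    then show "(\<lambda>n. d k (y n)) \<longlonglongrightarrow> h k" by (rule LIM_zero_cancel)
  qed
  with \<open>z \<in> U\<close> show ?thesis by blast
qed

lemma one_point_modulus_extension:
  assumes "modulus_of_continuity w" and "Metric_space Z dZ"
    and "Metric_space.mtotally_bounded Z dZ A"
    and f: "controlled_map (modulus_relation w) A dZ U d f" and "x \<in> Z"
  shows "\<exists>y\<in>U. \<forall>a\<in>A. d y (f a) \<le> w (dZ x a)"
proof (cases "A = {}")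
  case True
  obtain y where "y \<in> U"
    using katetov_realized_finite[of "{}"] by (auto simp: katetov_on_def)
  with True show ?thesis by blast
next
  case False
  interpret w: modulus_of_continuity w by fact
  interpret Metric_space12 Z dZ U d
    using assms(2) Metric_space_axioms by (rule Metric_space12.intro)
  have "A \<subseteq> Z" using assms(3) by (rule M1.mtotally_bounded_imp_subset)
  have fU: "f a \<in> U" and f_le: "d (f a) (f b) \<le> w (dZ a b)" if "a \<in> A" "b \<in> A" for a b
    using f that unfolding M1.controlled_map_modulus_iff by auto
  define h where "h z = (INF a\<in>A. d z (f a) + w (dZ x a))" for z
  have "d (f a) (f b) \<le> w (dZ x a) + w (dZ x b)" if "a \<in> A" "b \<in> A" for a b
  proof -
    have "dZ a b \<le> dZ x a + dZ x b"
      using that \<open>A \<subseteq> Z\<close> \<open>x \<in> Z\<close> by (intro M1.triangle'') auto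
    then have "d (f a) (f b) \<le> w (dZ x a + dZ x b)"
      using f_le[OF that] w.mono[of "dZ a b"] by force
    also have "\<dots> \<le> w (dZ x a) + w (dZ x b)" by (simp add: w.subadditive)
    finally show ?thesis .
  qed
  then have "katetov_on U h"
    unfolding h_def using False fU by (intro katetov_on_INF) auto
  moreover have "mtotally_bounded (f ` A)"
    using w.distance_control_modulus f assms(3) by (rule controlled_map_imp_mtotally_bounded_image)
  ultimately obtain y where y: "y \<in> U" "\<forall>z\<in>f ` A. d y z = h z"
    using katetov_realized_totally_bounded[of "f ` A" h] katetov_on_subset[of U h "f ` A"]
      mtotally_bounded_imp_subset[of "f ` A"] by blast
  have "h (f a) \<le> d (f a) (f a) + w (dZ x a)" if "a \<in> A" for a
    unfolding h_def using that by (intro cINF_lower bdd_belowI2[of _ 0]) (auto simp: w.nonneg)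
  with y fU show ?thesis by (intro bexI[of _ y]) auto
qed

lemma one_point_isometric_extension:
  assumes "Metric_space Z dZ" and "Metric_space.mtotally_bounded Z dZ A"
    and f: "isometric_embedding A dZ U d f" and "x \<in> Z"
  shows "\<exists>y\<in>U. \<forall>a\<in>A. d y (f a) = dZ x a"
proof -
  interpret Metric_space12 Z dZ U d
    using assms(1) Metric_space_axioms by (rule Metric_space12.intro)
  have "A \<subseteq> Z" using assms(2) by (rule M1.mtotally_bounded_imp_subset)
  have "mtotally_bounded (f ` A)"
    using distance_control_Id f assms(2) unfolding controlled_map_Id_iff[symmetric]
    by (rule controlled_map_imp_mtotally_bounded_image)
  then obtain y where y: "y \<in> U" "\<forall>z\<in>f ` A. d y z = dZ x (inv_into A f z)"
    using katetov_realized_totally_bounded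
      katetov_on_isometric_image[OF assms(1) \<open>A \<subseteq> Z\<close> \<open>x \<in> Z\<close> f] by blast
  moreover have "inj_on f A"
    using M1.subspace[OF \<open>A \<subseteq> Z\<close>] f Metric_space_axioms by (rule isometric_embedding_inj_on)
  ultimately show ?thesis by (intro bexI[of _ y]) auto
qed

theorem modulus_extension:
  assumes w: "modulus_of_continuity w" and Z: "Metric_space Z dZ"
    and "separable_space (Metric_space.mtopology Z dZ)" and "Metric_space.mtotally_bounded Z dZ A"
    and "controlled_map (modulus_relation w) A dZ U d f"
  obtains g where "controlled_map (modulus_relation w) Z dZ U d g" and "\<And>x. x \<in> A \<Longrightarrow> g x = f x"
proof -
  interpret Metric_space12 Z dZ U d
    using Z Metric_space_axioms by (rule Metric_space12.intro)
  have "\<exists>y\<in>U. \<forall>x\<in>B. (dZ z x, d y (g x)) \<in> modulus_relation w"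
    if "M1.mtotally_bounded B" "controlled_map (modulus_relation w) B dZ U d g" "z \<in> Z" for B g z
    using one_point_modulus_extension[OF w Z that] by (simp add: modulus_relation_def)
  with assms(3) complete modulus_of_continuity.distance_control_modulus[OF w] assms(4,5)
  show ?thesis using that by (rule controlled_map_extension)
qed

theorem isometric_extension:
  assumes Z: "Metric_space Z dZ"
    and "separable_space (Metric_space.mtopology Z dZ)" and "Metric_space.mtotally_bounded Z dZ A"
    and "isometric_embedding A dZ U d f"
  obtains g where "isometric_embedding Z dZ U d g" and "\<And>x. x \<in> A \<Longrightarrow> g x = f x"
proof -
  interpret Metric_space12 Z dZ U d
    using Z Metric_space_axioms by (rule Metric_space12.intro)
  have "\<exists>y\<in>U. \<forall>x\<in>B. (dZ z x, d y (g x)) \<in> Id"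
    if "M1.mtotally_bounded B" "controlled_map Id B dZ U d g" "z \<in> Z" for B g z
    using one_point_isometric_extension[OF Z that(1) _ that(3)] that(2)
    by (force simp: controlled_map_Id_iff)
  with assms(2) complete distance_control_Id assms(3,4)[folded controlled_map_Id_iff]
  show ?thesis using that[unfolded controlled_map_Id_iff[symmetric]]
    by (rule controlled_map_extension)
qed

end

subsection \<open>Contractions and attractors\<close>

lemma (in rakotch_modulus) le_max_linear:
  assumes "0 < e"
  obtains c where "c < 1" and "\<And>t. 0 \<le> t \<Longrightarrow> w t \<le> max e (c * t)"
proof -
  obtain c where "c < 1" and c: "\<And>t. e < t \<Longrightarrow> w t \<le> c * t"
    using rakotch_conditionE[OF rakotch assms] by metis
  have "w t \<le> e" if "0 \<le> t" "t \<le> e" for t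
    using mono[OF that] rakotch_condition_le[OF rakotch assms] by linarith
  with \<open>c < 1\<close> c that show ?thesis by (metis le_max_iff_disj not_le)
qed

context Metric_space12
begin

lemma rakotch_contraction_iff_modulus:
  "rakotch_contraction M1 d1 M2 d2 f \<longleftrightarrow>
     (\<exists>w. rakotch_modulus w \<and> controlled_map (modulus_relation w) M1 d1 M2 d2 f)"
proof
  assume "rakotch_contraction M1 d1 M2 d2 f"
  then obtain \<phi> where f: "f ` M1 \<subseteq> M2" "\<And>x y. x \<in> M1 \<Longrightarrow> y \<in> M1 \<Longrightarrow> d2 (f x) (f y) \<le> \<phi> (d1 x y)"
    and \<phi>: "rakotch_condition \<phi>"
    unfolding rakotch_contraction_def rakotch_condition_def by blast
  obtain w where w: "rakotch_modulus w" and \<phi>_le: "\<And>t. 0 < t \<Longrightarrow> \<phi> t \<le> w t"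
    using rakotch_condition_imp_modulus[OF \<phi>] by metis
  interpret w: rakotch_modulus w by fact
  have "d2 (f x) (f y) \<le> w (d1 x y)" if "x \<in> M1" "y \<in> M1" for x y
  proof (cases "x = y")
    case True
    then show ?thesis using f(1) that w.zero by (simp add: image_subset_iff)
  next
    case False
    then show ?thesis using f(2)[OF that] \<phi>_le[of "d1 x y"] that by fastforce
  qed
  with f(1) w show "\<exists>w. rakotch_modulus w \<and> controlled_map (modulus_relation w) M1 d1 M2 d2 f"
    unfolding M1.controlled_map_modulus_iff by blast
next
  assume "\<exists>w. rakotch_modulus w \<and> controlled_map (modulus_relation w) M1 d1 M2 d2 f"
  then obtain w where "rakotch_modulus w" "controlled_map (modulus_relation w) M1 d1 M2 d2 f"
    by blast
  interpret rakotch_modulus w by fact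
  show "rakotch_contraction M1 d1 M2 d2 f"
    using \<open>controlled_map _ _ _ _ _ _\<close> nonneg rakotch
    unfolding rakotch_contraction_def M1.controlled_map_modulus_iff rakotch_condition_def by blast
qed

lemma banach_contraction_iff_modulus:
  "banach_contraction M1 d1 M2 d2 f \<longleftrightarrow>
     (\<exists>w. banach_modulus w \<and> controlled_map (modulus_relation w) M1 d1 M2 d2 f)"
proof
  assume "banach_contraction M1 d1 M2 d2 f"
  then obtain L where "L < 1" and f: "f ` M1 \<subseteq> M2"
      "\<And>x y. x \<in> M1 \<Longrightarrow> y \<in> M1 \<Longrightarrow> d2 (f x) (f y) \<le> L * d1 x y"
    unfolding banach_contraction_def by blast
  have "L * d1 x y \<le> max 0 L * d1 x y" for x y by (intro mult_right_mono) auto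
  then have "controlled_map (modulus_relation ((*) (max 0 L))) M1 d1 M2 d2 f"
    unfolding M1.controlled_map_modulus_iff using f order_trans by blast
  moreover have "banach_modulus ((*) (max 0 L))"
    using \<open>L < 1\<close> unfolding banach_modulus_def by (intro exI[of _ "max 0 L"]) simp
  ultimately show "\<exists>w. banach_modulus w \<and> controlled_map (modulus_relation w) M1 d1 M2 d2 f"
    by blast
qed (auto simp: banach_contraction_def banach_modulus_def M1.controlled_map_modulus_iff)

end

context Metric_space
begin

lemma rakotch_contraction_imp_continuous_map:
  assumes "rakotch_contraction M d M d f"
  shows "continuous_map mtopology mtopology f"
proof -
  interpret Metric_space12 M d M d by unfold_locales
  obtain w where "rakotch_modulus w" and f: "controlled_map (modulus_relation w) M d M d f"
    using assms rakotch_contraction_iff_modulus by blast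
  interpret w: rakotch_modulus w by fact
  have "uniformly_continuous_map (submetric Self M) Self f"
    using w.distance_control_modulus f by (rule controlled_map_imp_uniformly_continuous)
  then show ?thesis
    using uniformly_continuous_imp_continuous_map[of Self Self f] submetric_mspace[of Self]
    by (simp add: mtopology_of_def)
qed

lemma rakotch_system_le_max:
  assumes "finite G" and "\<forall>g\<in>G. rakotch_contraction M d M d g" and "0 < e"
  obtains c where "0 \<le> c" "c < 1"
    and "\<And>g x y. g \<in> G \<Longrightarrow> x \<in> M \<Longrightarrow> y \<in> M \<Longrightarrow> d (g x) (g y) \<le> max e (c * d x y)"
proof -
  interpret Metric_space12 M d M d by unfold_locales
  have "\<exists>c<1. \<forall>x\<in>M. \<forall>y\<in>M. d (g x) (g y) \<le> max e (c * d x y)" if "g \<in> G" for g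
  proof -
    obtain w where "rakotch_modulus w" "controlled_map (modulus_relation w) M d M d g"
      using assms(2) \<open>g \<in> G\<close> rakotch_contraction_iff_modulus by blast
    then show ?thesis
      using rakotch_modulus.le_max_linear[OF _ \<open>0 < e\<close>, of w]
      unfolding controlled_map_modulus_iff by (metis nonneg order_trans)
  qed
  then obtain c where c: "\<And>g. g \<in> G \<Longrightarrow> c g < 1"
      "\<And>g x y. g \<in> G \<Longrightarrow> x \<in> M \<Longrightarrow> y \<in> M \<Longrightarrow> d (g x) (g y) \<le> max e (c g * d x y)"
    by metis
  define C where "C = Max (insert 0 (c ` G))"
  have "0 \<le> C" "C < 1" using \<open>finite G\<close> c(1) by (auto simp: C_def)
  moreover have "d (g x) (g y) \<le> max e (C * d x y)" if "g \<in> G" "x \<in> M" "y \<in> M" for g x y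
  proof -
    have "c g \<le> C" using \<open>finite G\<close> \<open>g \<in> G\<close> by (auto simp: C_def)
    then have "max e (c g * d x y) \<le> max e (C * d x y)"
      by (intro max.mono mult_right_mono) auto
    with c(2)[OF that] show ?thesis by linarith
  qed
  ultimately show ?thesis by (rule that)
qed

definition hausdorff_within :: "real \<Rightarrow> 'a set \<Rightarrow> 'a set \<Rightarrow> bool" where
  "hausdorff_within r A B \<longleftrightarrow> (\<forall>x\<in>A. \<exists>y\<in>B. d x y \<le> r) \<and> (\<forall>y\<in>B. \<exists>x\<in>A. d x y \<le> r)"

lemma hausdorff_dist_bounds:
  assumes "A \<noteq> {}" "B \<noteq> {}" and AB: "hausdorff_within r A B"
  shows "0 \<le> hausdorff_dist d A B" and "hausdorff_dist d A B \<le> r"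
proof -
  have bdd: "bdd_below (d x ` B)" "bdd_below ((\<lambda>x. d x y) ` A)" for x y
    by (auto intro!: bdd_belowI2[of _ 0])
  have to_B: "(INF y\<in>B. d x y) \<le> r" if "x \<in> A" for x
    using AB that cINF_lower2[OF bdd(1)] unfolding hausdorff_within_def by blast
  have to_A: "(INF x\<in>A. d x y) \<le> r" if "y \<in> B" for y
    using AB that cINF_lower2[OF bdd(2)] unfolding hausdorff_within_def by blast
  show "hausdorff_dist d A B \<le> r"
    unfolding hausdorff_dist_def using assms(1,2) to_A to_B by (auto intro!: cSUP_least)
  obtain x where "x \<in> A" using assms(1) by blast
  have "0 \<le> (INF y\<in>B. d x y)" using assms(2) by (intro cINF_greatest) auto
  also have "\<dots> \<le> (SUP x\<in>A. INF y\<in>B. d x y)"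
    using \<open>x \<in> A\<close> to_B by (intro cSUP_upper bdd_aboveI2[of _ _ r])
  finally show "0 \<le> hausdorff_dist d A B" unfolding hausdorff_dist_def by simp
qed

lemma hausdorff_within_fs_image:
  assumes "hausdorff_within r A B"
    and "\<And>g x y. g \<in> G \<Longrightarrow> x \<in> A \<Longrightarrow> y \<in> B \<Longrightarrow> d x y \<le> r \<Longrightarrow> d (g x) (g y) \<le> s"
  shows "hausdorff_within s (fs_image G A) (fs_image G B)"
  using assms unfolding hausdorff_within_def fs_image_def by (simp add: ball_UN bex_UN) meson

lemma fs_image_iterate_subset_nonempty:
  assumes "\<And>g. g \<in> G \<Longrightarrow> g ` M \<subseteq> M" and "G \<noteq> {}" and "K \<subseteq> M" "K \<noteq> {}"
  shows "(fs_image G ^^ n) K \<subseteq> M" and "(fs_image G ^^ n) K \<noteq> {}"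
proof (induction n)
  case (Suc n)
  case 1 show ?case using Suc assms(1) by (fastforce simp: fs_image_def)
  case 2 show ?case using Suc assms(2) by (auto simp: fs_image_def)
qed (use assms(3,4) in auto)

lemma hausdorff_within_fs_image_iterate:
  assumes GM: "\<And>g. g \<in> G \<Longrightarrow> g ` M \<subseteq> M" and "G \<noteq> {}" and "K \<subseteq> M" "K \<noteq> {}" "A \<subseteq> M"
    and "fs_image G A = A" and "hausdorff_within R K A" and "0 \<le> e" "0 \<le> c" "c \<le> 1"
    and contr: "\<And>g x y. g \<in> G \<Longrightarrow> x \<in> M \<Longrightarrow> y \<in> M \<Longrightarrow> d (g x) (g y) \<le> max e (c * d x y)"
  shows "hausdorff_within (max e (c ^ n * R)) ((fs_image G ^^ n) K) A"
proof (induction n)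
  case 0
  have "hausdorff_within (max e R) K A"
    using assms(7) unfolding hausdorff_within_def by (meson max.coboundedI2)
  then show ?case by simp
next
  case (Suc n)
  have "d (g x) (g y) \<le> max e (c ^ Suc n * R)"
    if "g \<in> G" "x \<in> (fs_image G ^^ n) K" "y \<in> A" "d x y \<le> max e (c ^ n * R)" for g x y
  proof -
    have "x \<in> M" "y \<in> M" using that(2,3) fs_image_iterate_subset_nonempty[OF assms(1-4)] \<open>A \<subseteq> M\<close> by auto
    have "c * d x y \<le> c * max e (c ^ n * R)" using that(4) \<open>0 \<le> c\<close> by (rule mult_left_mono)
    also have "\<dots> = max (c * e) (c ^ Suc n * R)"
      using \<open>0 \<le> c\<close> by (simp add: max_mult_distrib_left mult.assoc)
    also have "\<dots> \<le> max e (c ^ Suc n * R)"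
      using assms(8-10) by (intro max.mono mult_left_le_one_le) auto
    finally show ?thesis using contr[OF that(1) \<open>x \<in> M\<close> \<open>y \<in> M\<close>] by simp
  qed
  with Suc have "hausdorff_within (max e (c ^ Suc n * R))
      (fs_image G ((fs_image G ^^ n) K)) (fs_image G A)"
    by (rule hausdorff_within_fs_image)
  with assms(6) show ?case by simp
qed

theorem rakotch_system_attractor:
  assumes "finite G" and G: "\<forall>g\<in>G. rakotch_contraction M d M d g"
    and A: "A \<noteq> {}" "compactin mtopology A" "fs_image G A = A"
  shows "attractor M d G A"
  unfolding attractor_def
proof (intro conjI allI impI A)
  fix K assume K: "K \<noteq> {} \<and> compactin mtopology K"
  have GM: "g ` M \<subseteq> M" if "g \<in> G" for g
    using G that by (simp add: rakotch_contraction_def)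
  have "G \<noteq> {}" using A(1,3) by (auto simp: fs_image_def)
  have "K \<subseteq> M" "A \<subseteq> M" using K A(2) compactin_subset_topspace by fastforce+
  have "mbounded (K \<union> A)"
    using K A(2) by (intro compactin_imp_mbounded compactin_Un) auto
  then obtain R where "\<forall>x\<in>K \<union> A. \<forall>y\<in>K \<union> A. d x y \<le> R"
    unfolding mbounded_alt by blast
  then have R: "hausdorff_within R K A"
    using K A(1) unfolding hausdorff_within_def by blast
  let ?D = "\<lambda>n. hausdorff_dist d ((fs_image G ^^ n) K) A"
  have D: "0 \<le> ?D n \<and> ?D n \<le> r" if "hausdorff_within r ((fs_image G ^^ n) K) A" for n r
    using fs_image_iterate_subset_nonempty(2)[OF GM \<open>G \<noteq> {}\<close> \<open>K \<subseteq> M\<close>] K A(1) that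
    by (simp add: hausdorff_dist_bounds)
  show "?D \<longlonglongrightarrow> 0"
  proof (rule tendstoI)
    fix e :: real assume "0 < e"
    then obtain c where c: "0 \<le> c" "c < 1"
      "\<And>g x y. g \<in> G \<Longrightarrow> x \<in> M \<Longrightarrow> y \<in> M \<Longrightarrow> d (g x) (g y) \<le> max (e / 2) (c * d x y)"
      using rakotch_system_le_max[OF assms(1) G, of "e / 2"] by auto
    have close: "0 \<le> ?D n \<and> ?D n \<le> max (e / 2) (c ^ n * R)" for n
      using K c \<open>0 < e\<close>
      by (intro D hausdorff_within_fs_image_iterate GM \<open>G \<noteq> {}\<close> \<open>K \<subseteq> M\<close> \<open>A \<subseteq> M\<close> A(3) R) auto
    have "(\<lambda>n. c ^ n * R) \<longlonglongrightarrow> 0"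
      using c by (intro tendsto_mult_left_zero LIMSEQ_power_zero) auto
    then have "\<forall>\<^sub>F n in sequentially. c ^ n * R < e"
      using \<open>0 < e\<close> by (rule order_tendstoD(2))
    then show "\<forall>\<^sub>F n in sequentially. dist (?D n) 0 < e"
    proof eventually_elim
      case (elim n)
      have "?D n \<le> max (e / 2) (c ^ n * R)" using close by blast
      also have "\<dots> < e" using elim \<open>0 < e\<close> by simp
      finally show ?case using close[of n] by (simp add: dist_real_def)
    qed
  qed
qed

end

subsection \<open>Realization of compact fractals\<close>

lemma (in Metric_space) mtotally_bounded_imp_separable_space:
  assumes "mtotally_bounded M"
  shows "separable_space mtopology"
proof -
  have "\<forall>n. \<exists>N. finite N \<and> N \<subseteq> M \<and> M \<subseteq> (\<Union>x\<in>N. mball x (inverse (real (Suc n))))"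
    using assms unfolding mtotally_bounded_def
    by (metis inverse_positive_iff_positive of_nat_0_less_iff zero_less_Suc)
  then obtain N where N: "\<And>n. finite (N n)" "\<And>n. N n \<subseteq> M"
      "\<And>n. M \<subseteq> (\<Union>x\<in>N n. mball x (inverse (real (Suc n))))"
    by metis
  have "\<exists>y\<in>\<Union>(range N). y \<in> mball x r" if "x \<in> M" "0 < r" for x r
  proof -
    obtain n where n: "inverse (real (Suc n)) < r" using reals_Archimedean[OF \<open>0 < r\<close>] by auto
    obtain y where y: "y \<in> N n" "x \<in> mball y (inverse (real (Suc n)))"
      using N(3)[of n] \<open>x \<in> M\<close> by blast
    then have "y \<in> mball x r" using n commute[of x y] by simp
    with y show ?thesis by blast
  qed
  then have "mtopology closure_of \<Union>(range N) = M"
    unfolding metric_closure_of by blast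
  moreover have "countable (\<Union>(range N))" using N(1) by (simp add: countable_finite)
  moreover have "\<Union>(range N) \<subseteq> M" using N(2) by blast
  ultimately show ?thesis unfolding separable_space_def by auto
qed

lemma (in Metric_space12) isometric_embedding_imp_compactin_image:
  assumes "compact_space M1.mtopology" and "isometric_embedding M1 d1 M2 d2 e"
  shows "compactin M2.mtopology (e ` M1)"
proof (rule image_compactin)
  show "compactin M1.mtopology M1" using assms(1) by (simp add: compact_space_def)
  show "continuous_map M1.mtopology M2.mtopology e"
    unfolding M1.metric_continuous_map[OF M2.Metric_space_axioms]
    using assms(2) by (auto simp: isometric_embedding_def)
qed

context Urysohn_space
begin

lemma conjugate_extension:
  assumes w: "modulus_of_continuity w" and X: "Metric_space X dX"
    and e: "isometric_embedding X dX U d e" and "mtotally_bounded (e ` X)"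
    and f: "controlled_map (modulus_relation w) X dX X dX f"
  obtains g where "controlled_map (modulus_relation w) U d U d g"
    and "\<And>x. x \<in> X \<Longrightarrow> g (e x) = e (f x)"
proof -
  interpret X: Metric_space X dX by fact
  let ?f = "\<lambda>a. e (f (inv_into X e a))"
  have inv: "inv_into X e (e x) = x" if "x \<in> X" for x
    using isometric_embedding_inj_on[OF X e Metric_space_axioms] that by simp
  then have "controlled_map (modulus_relation w) (e ` X) d U d ?f"
    using e f by (auto simp: controlled_map_def isometric_embedding_def image_subset_iff)
  then obtain g where "controlled_map (modulus_relation w) U d U d g"
      "\<And>a. a \<in> e ` X \<Longrightarrow> g a = ?f a"
    using modulus_extension[OF w Metric_space_axioms separable assms(4), of ?f] by blast
  with inv that show ?thesis by simp
qed

theorem compact_fractal_realized: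
  assumes X: "Metric_space X dX" "X \<noteq> {}" "compact_space (Metric_space.mtopology X dX)"
    and P: "\<And>w. P w \<Longrightarrow> rakotch_modulus w"
    and F: "finite F" "X = fs_image F X"
      "\<forall>f\<in>F. \<exists>w. P w \<and> controlled_map (modulus_relation w) X dX X dX f"
  shows "\<exists>G A. function_system U d G \<and>
    (\<forall>g\<in>G. \<exists>w. P w \<and> controlled_map (modulus_relation w) U d U d g) \<and>
    attractor U d G A \<and> isometric X dX A d"
proof -
  interpret Metric_space12 X dX U d
    using X(1) Metric_space_axioms by (rule Metric_space12.intro)
  interpret self: Metric_space12 U d U d by unfold_locales
  have "M1.mtotally_bounded X"
    using X(3) M1.compactin_imp_mtotally_bounded by (simp add: compact_space_def)
  then obtain e where e: "isometric_embedding X dX U d e"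
    using isometric_extension[OF X(1) M1.mtotally_bounded_imp_separable_space
        M1.mtotally_bounded_empty]
    by (auto simp: isometric_embedding_def)
  have A: "compactin mtopology (e ` X)"
    using X(3) e by (rule isometric_embedding_imp_compactin_image)
  have "\<exists>g. (\<exists>w. P w \<and> controlled_map (modulus_relation w) U d U d g) \<and> (\<forall>x\<in>X. g (e x) = e (f x))"
    if "f \<in> F" for f
  proof -
    obtain w where w: "P w" "controlled_map (modulus_relation w) X dX X dX f"
      using F(3) \<open>f \<in> F\<close> by blast
    then have "modulus_of_continuity w" using P rakotch_modulus.axioms(1) by blast
    then show ?thesis
      using conjugate_extension[OF _ X(1) e compactin_imp_mtotally_bounded[OF A] w(2)] w(1) by metis
  qed
  then obtain g
    where g: "\<And>f. f \<in> F \<Longrightarrow> \<exists>w. P w \<and> controlled_map (modulus_relation w) U d U d (g f)"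
      and conj: "\<And>f x. f \<in> F \<Longrightarrow> x \<in> X \<Longrightarrow> g f (e x) = e (f x)"
    by metis
  have contractions: "\<forall>h\<in>g ` F. rakotch_contraction U d U d h"
    using g P self.rakotch_contraction_iff_modulus by blast
  have "fs_image (g ` F) (e ` X) = e ` fs_image F X"
    unfolding fs_image_def by (simp add: image_UN image_image conj)
  also have "\<dots> = e ` X" using F(2) by simp
  finally have "attractor U d (g ` F) (e ` X)"
    using F(1) contractions X(2) A by (intro rakotch_system_attractor) auto
  moreover have "function_system U d (g ` F)"
    using F(1) contractions rakotch_contraction_imp_continuous_map
    by (simp add: function_system_def)
  moreover have "isometric X dX (e ` X) d"
    using e by (auto simp: isometric_def isometric_embedding_def)
  ultimately show ?thesis using g by blast
qed

end

theorem theorem1p4: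
  fixes U :: "'b set" and dU :: "'b \<Rightarrow> 'b \<Rightarrow> real"
    and X :: "'a set" and dX :: "'a \<Rightarrow> 'a \<Rightarrow> real"
  assumes "urysohn_space U dU"
    and "Metric_space X dX"
    and "X \<noteq> {}"
    and "compact_space (Metric_space.mtopology X dX)"
  shows "(rakotch_fractal X dX \<longrightarrow>
           (\<exists>G A. function_system U dU G \<and> (\<forall>g\<in>G. rakotch_contraction U dU U dU g) \<and>
                  attractor U dU G A \<and> isometric X dX A dU))
       \<and> (banach_fractal X dX \<longrightarrow>
           (\<exists>G A. function_system U dU G \<and> (\<forall>g\<in>G. banach_contraction U dU U dU g) \<and>
                  attractor U dU G A \<and> isometric X dX A dU))"
proof -
  interpret U: Urysohn_space U dU
    using assms(1) by (simp add: Urysohn_space_def Urysohn_space_axioms_def urysohn_space_def)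
  interpret X: Metric_space X dX by fact
  interpret X_self: Metric_space12 X dX X dX by unfold_locales
  interpret U_self: Metric_space12 U dU U dU by unfold_locales
  note realized = U.compact_fractal_realized[OF assms(2-4)]
  show ?thesis
  proof (intro conjI impI)
    assume "rakotch_fractal X dX"
    then show "\<exists>G A. function_system U dU G \<and> (\<forall>g\<in>G. rakotch_contraction U dU U dU g) \<and>
        attractor U dU G A \<and> isometric X dX A dU"
      unfolding rakotch_fractal_def function_system_def[of X]
        X_self.rakotch_contraction_iff_modulus U_self.rakotch_contraction_iff_modulus
      using realized[of rakotch_modulus] by blast
  next
    assume "banach_fractal X dX"
    then show "\<exists>G A. function_system U dU G \<and> (\<forall>g\<in>G. banach_contraction U dU U dU g) \<and>
        attractor U dU G A \<and> isometric X dX A dU"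
      unfolding banach_fractal_def function_system_def[of X]
        X_self.banach_contraction_iff_modulus U_self.banach_contraction_iff_modulus
      using realized[OF banach_modulus_imp_rakotch_modulus] by blast
  qed
qed

end
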